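(* Let $r\ge 0$ be an integer and let $S$ be the $(p,m,2)$ signed graph consisting of a positive edge, to which are attached $2$ negative pendant edges and $1$ positive pendant edge at one end as well as $r$ positive pendant edges at the other end. If $r\geq 5$ then $S$ is not additively graceful.
   Context: A signed graph $S$ is a finite simple graph on $p$ vertices in which $m$ edges are specified as positive and the remaining $n$ edges are specified as negative; it is then called a $(p,m,n)$ signed graph, with sets of positive and negative edges $E^+(S)$ and $E^-(S)$. Attaching a pendant edge at a vertex $z$ means adding a new vertex of degree 1 joined to $z$. Thus $S$ has positive edges $z_1z_2$, $z_1v_1$, $z_2w_i$ ($1\le i\le r$) and negative edges $z_1u_1$, $z_1u_2$, all these vertices being distinct, and no other vertices or edges. An additively graceful labeling of a $(p,m,n)$ signed graph $S=(V,E)$ is an injective map $f:V\to\{0,1,\dots,m+\lceil\frac{n+1}{2}\rceil\}$ such that, with $f^*(uv)=f(u)+f(v)$ for $uv\in E^-(S)$ and $f^*(uv)=|f(u)-f(v)|$ for $uv\in E^+(S)$, one has $\{f^*(uv):uv\in E^-(S)\}=\{1,2,\dots,n\}$ and $\{f^*(uv):uv\in E^+(S)\}=\{1,2,\dots,m\}$. $S$ is additively graceful if it admits such a labeling. *)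

theory Defs
  imports Complex_Main
begin

text \<open>Edges are two-element vertex sets, so \<open>{u, v}\<close> is the undirected edge \<open>uv\<close>.\<close>

record 'a signed_graph =
  verts :: "'a set"
  pos_edges :: "'a set set"
  neg_edges :: "'a set set"

definition is_signed_graph :: "nat \<Rightarrow> nat \<Rightarrow> nat \<Rightarrow> 'a signed_graph \<Rightarrow> bool" where
  "is_signed_graph p m n S \<longleftrightarrow>
     finite (verts S) \<and> card (verts S) = p \<and>
     (\<forall>e \<in> pos_edges S \<union> neg_edges S. e \<subseteq> verts S \<and> card e = 2) \<and>
     pos_edges S \<inter> neg_edges S = {} \<and>
     card (pos_edges S) = m \<and> card (neg_edges S) = n"

definition additively_graceful_labeling :: "'a signed_graph \<Rightarrow> ('a \<Rightarrow> int) \<Rightarrow> bool" where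
  "additively_graceful_labeling S f \<longleftrightarrow>
     (let m = card (pos_edges S); n = card (neg_edges S) in
        inj_on f (verts S) \<and>
        f ` verts S \<subseteq> {0 .. int m + \<lceil>(real n + 1) / 2\<rceil>} \<and>
        {f u + f v | u v. {u, v} \<in> neg_edges S} = {1 .. int n} \<and>
        {\<bar>f u - f v\<bar> | u v. {u, v} \<in> pos_edges S} = {1 .. int m})"

definition additively_graceful :: "'a signed_graph \<Rightarrow> bool" where
  "additively_graceful S \<longleftrightarrow> (\<exists>f. additively_graceful_labeling S f)"

text \<open>
  The positive edge \<open>z1 z2\<close> with two negative pendant edges \<open>z1 u1\<close>, \<open>z1 u2\<close> and one positive
  pendant edge \<open>z1 v1\<close> attached at \<open>z1\<close>, and \<open>r\<close> positive pendant edges \<open>z2 (w i)\<close> attached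
  at \<open>z2\<close>. The names of the vertices are arbitrary, so the predicate describes \<open>S\<close> up to isomorphism.
\<close>

definition pendant_signed_graph :: "nat \<Rightarrow> 'a signed_graph \<Rightarrow> bool" where
  "pendant_signed_graph r S \<longleftrightarrow>
     (\<exists>z1 z2 v1 u1 u2 w.
        distinct [z1, z2, v1, u1, u2] \<and> inj_on w {1..r} \<and>
        w ` {1..r} \<inter> {z1, z2, v1, u1, u2} = {} \<and>
        verts S = {z1, z2, v1, u1, u2} \<union> w ` {1..r} \<and>
        pos_edges S = {{z1, z2}, {z1, v1}} \<union> {{z2, w i} | i. i \<in> {1..r}} \<and>
        neg_edges S = {{z1, u1}, {z1, u2}})"

lemma pendant_signed_graph_is_signed_graph:
  assumes "pendant_signed_graph r S"
  shows "is_signed_graph (r + 5) (r + 2) 2 S"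
proof -
  obtain z1 z2 v1 u1 u2 w where d: "distinct [z1, z2, v1, u1, u2]" and inj: "inj_on w {1..r}"
    and disj: "w ` {1..r} \<inter> {z1, z2, v1, u1, u2} = {}"
    and V: "verts S = {z1, z2, v1, u1, u2} \<union> w ` {1..r}"
    and P: "pos_edges S = {{z1, z2}, {z1, v1}} \<union> {{z2, w i} | i. i \<in> {1..r}}"
    and N: "neg_edges S = {{z1, u1}, {z1, u2}}"
    using assms unfolding pendant_signed_graph_def by (elim exE conjE) (rule that)
  have w: "w i \<notin> {z1, z2, v1, u1, u2}" if "i \<in> {1..r}" for i
    using disj that by blast
  have W: "{{z2, w i} | i. i \<in> {1..r}} = (\<lambda>i. {z2, w i}) ` {1..r}"
    by blast
  have ne: "z1 \<noteq> z2" "z1 \<noteq> v1" "z1 \<noteq> u1" "z1 \<noteq> u2" "z2 \<noteq> v1" "z2 \<noteq> u1" "z2 \<noteq> u2"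
    "v1 \<noteq> u1" "v1 \<noteq> u2" "u1 \<noteq> u2"
    using d by simp_all
  have "card {z1, z2, v1, u1, u2} = 5"
    using ne by simp
  moreover have "card (w ` {1..r}) = r"
    using card_image[OF inj] by simp
  moreover have "card (verts S) = card {z1, z2, v1, u1, u2} + card (w ` {1..r})"
    unfolding V by (rule card_Un_disjoint) (use disj in \<open>simp_all add: Int_commute\<close>)
  ultimately have cV: "card (verts S) = r + 5" by linarith
  have injE: "inj_on (\<lambda>i. {z2, w i}) {1..r}"
    by (rule inj_onI) (metis doubleton_eq_iff inj inj_onD)
  have "{z1, z2} \<noteq> {z2, w i}" "{z1, v1} \<noteq> {z2, w i}"
    "{z1, u1} \<noteq> {z2, w i}" "{z1, u2} \<noteq> {z2, w i}" if "i \<in> {1..r}" for i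
    using w[OF that] ne unfolding doubleton_eq_iff by blast+
  then have nE: "{z1, z2} \<notin> (\<lambda>i. {z2, w i}) ` {1..r}" "{z1, v1} \<notin> (\<lambda>i. {z2, w i}) ` {1..r}"
    "{z1, u1} \<notin> (\<lambda>i. {z2, w i}) ` {1..r}" "{z1, u2} \<notin> (\<lambda>i. {z2, w i}) ` {1..r}"
    by blast+
  have n2: "{z1, z2} \<noteq> {z1, v1}" "{z1, u1} \<noteq> {z1, u2}" "{z1, u1} \<noteq> {z1, z2}"
    "{z1, u1} \<noteq> {z1, v1}" "{z1, u2} \<noteq> {z1, z2}" "{z1, u2} \<noteq> {z1, v1}"
    using ne unfolding doubleton_eq_iff by blast+
  have "card ((\<lambda>i. {z2, w i}) ` {1..r}) = r"
    using card_image[OF injE] by simp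
  moreover have "card {{z1, z2}, {z1, v1}} = 2"
    using n2(1) by simp
  moreover have "card (pos_edges S) = card {{z1, z2}, {z1, v1}} + card ((\<lambda>i. {z2, w i}) ` {1..r})"
    unfolding P W by (rule card_Un_disjoint) (use nE in simp_all)
  ultimately have cP: "card (pos_edges S) = r + 2" by linarith
  have cN: "card (neg_edges S) = 2"
    unfolding N using n2(2) by simp
  have "e \<subseteq> verts S \<and> card e = 2" if e: "e \<in> pos_edges S \<union> neg_edges S" for e
  proof (cases "e \<in> (\<lambda>i. {z2, w i}) ` {1..r}")
    case True
    then obtain i where i: "i \<in> {1..r}" "e = {z2, w i}" by blast
    have "z2 \<noteq> w i" using w[OF i(1)] by blast
    then show ?thesis using i unfolding V by simp
  next
    case False
    then have "e = {z1, z2} \<or> e = {z1, v1} \<or> e = {z1, u1} \<or> e = {z1, u2}"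
      using e unfolding P N W by blast
    then show ?thesis using ne(1-4) unfolding V by (elim disjE) simp_all
  qed
  moreover have "pos_edges S \<inter> neg_edges S = {}"
    unfolding P N W using n2 nE by simp
  moreover have "finite (verts S)"
    unfolding V by simp
  ultimately show ?thesis
    unfolding is_signed_graph_def using cV cP cN by blast
qed

end

theory Submission
  imports Defs
begin

text \<open>
  The graph has \<open>r + 5\<close> vertices and \<open>m = r + 2\<close> positive edges, so a labeling takes its values
  in \<open>{0..r+4}\<close>, a set with exactly as many elements as there are vertices: every value is used.
  The two negative edges at \<open>z1\<close> have induced labels \<open>1\<close> and \<open>2\<close>, which forces \<open>z1\<close> to be
  labeled \<open>0\<close> and its two negative neighbours to be labeled \<open>1\<close> and \<open>2\<close>.

  Write \<open>a\<close> and \<open>b\<close> for the labels of \<open>z2\<close> and \<open>v1\<close>. They are also the induced labels of the positive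
  edges at \<open>z1\<close>, and the pendant vertices at \<open>z2\<close> receive exactly the rest \<open>{3..r+4} - {a, b}\<close>.
  Since there are as many positive edges as induced positive labels, the numbers \<open>a\<close>, \<open>b\<close> and
  \<open>\<bar>a - x\<bar>\<close>, for \<open>x\<close> in the rest, are pairwise distinct. Two labels \<open>a - k\<close> and
  \<open>a + k\<close> would induce the same edge label, and only one pair of this kind can be broken up by
  removing \<open>b\<close>. As an edge label, \<open>a\<close> is at most \<open>r + 2\<close>, so for \<open>a \<ge> 5\<close> the pairs with \<open>k = 1\<close> and
  \<open>k = 2\<close> both fit into \<open>{3..r+4}\<close>; hence \<open>a\<close> is \<open>3\<close> or \<open>4\<close>. For \<open>a = 4\<close> the pair with \<open>k = 1\<close> forces
  \<open>b\<close> to be \<open>3\<close> or \<open>5\<close>, and the edge label \<open>4\<close> of \<open>z1 z2\<close> is repeated at the vertex labeled \<open>8\<close>.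
  For \<open>a = 3\<close> the edge label \<open>3\<close> is repeated at the vertex labeled \<open>6\<close> unless \<open>b = 6\<close>, and
  then the edge label \<open>6\<close> of \<open>z1 v1\<close> is repeated at the vertex labeled \<open>9\<close>. The bound
  \<open>r \<ge> 5\<close> says that \<open>9\<close> is among the available labels.
\<close>

text \<open>
  This is the arithmetic core, with \<open>n\<close> in the role of \<open>r\<close>. Equality of the two sets is a
  counting statement: the left-hand side is indexed by \<open>n + 2\<close> objects and has \<open>n + 2\<close>
  elements, so no value is attained twice.
\<close>

lemma no_distance_cover_from_two_centres:
  fixes a b :: int and n :: nat
  assumes cover: "{a, b} \<union> (\<lambda>x. \<bar>a - x\<bar>) ` ({3..int n + 4} - {a, b}) = {1..int n + 2}"
    and ab: "a \<noteq> b" "3 \<le> a" "3 \<le> b"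
    and n: "5 \<le> n"
  shows False
proof -
  define X where "X = {3..int n + 4} - {a, b}"
  let ?d = "\<lambda>x. \<bar>a - x\<bar>"
  have "a \<in> {1..int n + 2}" "b \<in> {1..int n + 2}"
    using cover by blast+
  then have le: "a \<le> int n + 2" "b \<le> int n + 2"
    by simp_all
  have finX: "finite X"
    by (simp add: X_def)
  have cardX: "card X = n"
    using ab le by (simp add: X_def card_Diff_subset)
  have card_cover: "card ({a, b} \<union> ?d ` X) = n + 2"
    using cover by (simp only: X_def) simp
  moreover have "card ({a, b} \<union> ?d ` X) + card ({a, b} \<inter> ?d ` X) = 2 + card (?d ` X)"
    using card_Un_Int[of "{a, b}" "?d ` X"] finX ab by simp
  moreover have "card (?d ` X) \<le> n"
    using card_image_le[OF finX, of ?d] cardX by simp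
  ultimately have "card (?d ` X) = card X" and "card ({a, b} \<inter> ?d ` X) = 0"
    using cardX by linarith+
  then have inj: "inj_on ?d X" and disj: "{a, b} \<inter> ?d ` X = {}"
    using finX by (simp_all add: eq_card_imp_inj_on)
  have mem: "x \<in> X \<longleftrightarrow> 3 \<le> x \<and> x \<le> int n + 4 \<and> x \<noteq> a \<and> x \<noteq> b" for x
    by (auto simp: X_def)
  have reflect: "\<not> (a - k \<in> X \<and> a + k \<in> X)" if "k > 0" for k
    using inj_onD[OF inj, of "a - k" "a + k"] that by auto
  have fresh: "?d x \<noteq> a \<and> ?d x \<noteq> b" if "x \<in> X" for x
    using disj that by blast
  \<comment> \<open>From \<open>a \<ge> 5\<close> on, \<open>b\<close> would have to lie both at distance \<open>1\<close> and at distance \<open>2\<close> from \<open>a\<close>.\<close>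
  have "a = 3 \<or> a = 4"
    using reflect[of 1] reflect[of 2] ab le by (auto simp: mem)
  then show False
  proof
    assume a: "a = 3"
    have "b = 6"
      using fresh[of 6] a n by (auto simp: mem)
    then show False
      using fresh[of 9] a n by (auto simp: mem)
  next
    assume a: "a = 4"
    have "b = 3 \<or> b = 5"
      using reflect[of 1] a n by (auto simp: mem)
    then show False
      using fresh[of 8] a n by (auto simp: mem)
  qed
qed

text \<open>
  Starting from \<open>z = 1\<close> one would get \<open>{x, y} = {0, 1}\<close>, so the value of \<open>z\<close> would occur again;
  this is where distinctness of the labels enters.
\<close>

lemma pair_sums_1_2_imp_centre_0:
  fixes x y z :: int
  assumes sums: "{z + x, z + y} = {1..2}"
    and "0 \<le> x" "0 \<le> y" "0 \<le> z" "z \<noteq> x" "z \<noteq> y"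
  shows "z = 0" and "{x, y} = {1, 2}"
proof -
  have "{1..2::int} = {1, 2}"
    by auto
  then have "z + x = 1 \<and> z + y = 2 \<or> z + x = 2 \<and> z + y = 1"
    using sums by (simp add: doubleton_eq_iff)
  then have "z = 0 \<and> (x = 1 \<and> y = 2 \<or> x = 2 \<and> y = 1)"
    using assms(2-) by presburger
  then show "z = 0" and "{x, y} = {1, 2}"
    by auto
qed

text \<open>
  An edge determines its ends only up to order, so the labels induced on a star are the
  values of \<open>g\<close> with the centre as first argument as soon as \<open>g\<close> is symmetric.
\<close>

lemma labels_of_two_stars:
  assumes sym: "\<And>u v. g u v = g v u"
  shows "{g u v | u v. {u, v} \<in> (\<lambda>v. {y, v}) ` A \<union> (\<lambda>v. {z, v}) ` B} = g y ` A \<union> g z ` B"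
proof
  show "{g u v | u v. {u, v} \<in> (\<lambda>v. {y, v}) ` A \<union> (\<lambda>v. {z, v}) ` B} \<subseteq> g y ` A \<union> g z ` B"
  proof clarify
    fix u v
    assume "{u, v} \<in> (\<lambda>v. {y, v}) ` A \<union> (\<lambda>v. {z, v}) ` B" and "g u v \<notin> g z ` B"
    then show "g u v \<in> g y ` A"
      using sym[of u v] unfolding image_iff Un_iff doubleton_eq_iff by metis
  qed
  show "g y ` A \<union> g z ` B \<subseteq> {g u v | u v. {u, v} \<in> (\<lambda>v. {y, v}) ` A \<union> (\<lambda>v. {z, v}) ` B}"
    by blast
qed

theorem theorem4p8:
  fixes S :: "'a signed_graph" and p m r :: nat
  assumes "is_signed_graph p m 2 S"
    and "pendant_signed_graph r S"
    and "r \<ge> 5"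
  shows "\<not> additively_graceful S"
proof
  assume "additively_graceful S"
  then obtain f where f: "additively_graceful_labeling S f"
    unfolding additively_graceful_def by blast
  have card: "finite (verts S)" "card (verts S) = r + 5" "card (pos_edges S) = r + 2"
    "card (neg_edges S) = 2"
    using pendant_signed_graph_is_signed_graph[OF assms(2)] unfolding is_signed_graph_def
    by blast+
  have "\<lceil>(real 2 + 1) / 2\<rceil> = 2"
    by (simp add: ceiling_eq_iff)
  then have inj: "inj_on f (verts S)"
    and range: "f ` verts S \<subseteq> {0..int r + 4}"
    and neg: "{f u + f v | u v. {u, v} \<in> neg_edges S} = {1..2}"
    and pos: "{\<bar>f u - f v\<bar> | u v. {u, v} \<in> pos_edges S} = {1..int r + 2}"
    using f unfolding additively_graceful_labeling_def Let_def card by (simp_all add: add.commute)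
  have "card (f ` verts S) = card {0..int r + 4}"
    using card_image[OF inj] card by simp
  then have onto: "f ` verts S = {0..int r + 4}"
    using range by (intro card_subset_eq) simp_all
  obtain z1 z2 v1 u1 u2 w where d: "distinct [z1, z2, v1, u1, u2]"
    and disj: "w ` {1..r} \<inter> {z1, z2, v1, u1, u2} = {}"
    and V: "verts S = {z1, z2, v1, u1, u2} \<union> w ` {1..r}"
    and P: "pos_edges S = {{z1, z2}, {z1, v1}} \<union> {{z2, w i} | i. i \<in> {1..r}}"
    and N: "neg_edges S = {{z1, u1}, {z1, u2}}"
    using assms(2) unfolding pendant_signed_graph_def by (elim exE conjE) (rule that)
  define a b where "a = f z2" and "b = f v1"
  have ne: "f x \<noteq> f y" if "x \<in> verts S" "y \<in> verts S" "x \<noteq> y" for x y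
    using inj that by (auto dest: inj_onD)
  have nonneg: "0 \<le> f x" if "x \<in> verts S" for x
    using range that by auto
  have mem: "z1 \<in> verts S" "z2 \<in> verts S" "v1 \<in> verts S" "u1 \<in> verts S" "u2 \<in> verts S"
    unfolding V by simp_all
  have "{f u + f v | u v. {u, v} \<in> neg_edges S} = {f z1 + f u1, f z1 + f u2}"
    unfolding N by (auto simp: doubleton_eq_iff)
  then have sums: "{f z1 + f u1, f z1 + f u2} = {1..2}"
    using neg by simp
  have "0 \<le> f u1" "0 \<le> f u2" "0 \<le> f z1" "f z1 \<noteq> f u1" "f z1 \<noteq> f u2"
    using d by (simp_all add: mem ne nonneg)
  from pair_sums_1_2_imp_centre_0[OF sums this]
  have z1: "f z1 = 0" and u: "{f u1, f u2} = {1, 2}"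
    by blast+
  have core: "f ` {z1, z2, v1, u1, u2} = {0, 1, 2, a, b}"
    using z1 u by (auto simp: a_def b_def)
  have "w ` {1..r} = verts S - {z1, z2, v1, u1, u2}"
    using V disj by blast
  then have "f ` w ` {1..r} = f ` verts S - f ` {z1, z2, v1, u1, u2}"
    using inj_on_image_set_diff[OF inj Diff_subset, of "{z1, z2, v1, u1, u2}"] mem by simp
  also have "\<dots> = {3..int r + 4} - {a, b}"
    unfolding onto core by auto
  finally have rest: "f ` w ` {1..r} = {3..int r + 4} - {a, b}" .
  have ab: "a \<noteq> b" "3 \<le> a" "3 \<le> b"
  proof -
    show "a \<noteq> b"
      unfolding a_def b_def using d by (simp add: mem ne)
    have "3 \<le> f x" if x: "x \<in> {z2, v1}" for x
    proof -
      have "f x \<noteq> f z1" "f x \<noteq> f u1" "f x \<noteq> f u2" "0 \<le> f x"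
        using x d by (auto simp: mem ne nonneg)
      then have "f x \<notin> {0, 1, 2}" "0 \<le> f x"
        using z1 u by auto
      then show ?thesis
        by auto
    qed
    then show "3 \<le> a" "3 \<le> b"
      by (simp_all add: a_def b_def)
  qed
  have "pos_edges S = (\<lambda>v. {z1, v}) ` {z2, v1} \<union> (\<lambda>v. {z2, v}) ` w ` {1..r}"
    unfolding P by blast
  then have "{\<bar>f u - f v\<bar> | u v. {u, v} \<in> pos_edges S}
      = (\<lambda>v. \<bar>f z1 - f v\<bar>) ` {z2, v1} \<union> (\<lambda>v. \<bar>f z2 - f v\<bar>) ` w ` {1..r}"
    by (simp only: labels_of_two_stars[of "\<lambda>u v. \<bar>f u - f v\<bar>", OF abs_minus_commute])
  also have "\<dots> = {a, b} \<union> (\<lambda>x. \<bar>a - x\<bar>) ` f ` w ` {1..r}"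
    using z1 ab by (simp add: a_def b_def image_image)
  finally have "{a, b} \<union> (\<lambda>x. \<bar>a - x\<bar>) ` ({3..int r + 4} - {a, b}) = {1..int r + 2}"
    using pos rest by simp
  then show False
    using no_distance_cover_from_two_centres ab assms(3) by blast
qed

end
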